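(* For each positive integer $M$ there is $\epsilon_M>0$ such that for every $\alpha\in(0,\epsilon_M)$ there is no $M$-podal graphon $g$ with $(t_1(g),t_2(g),\tilde t_3(g),\tilde t_4(g))=(t_1(g_\alpha),t_2(g_\alpha),\tilde t_3(g_\alpha),\tilde t_4(g_\alpha))$.
   Context: A graphon is a symmetric measurable function $g:[0,1]^2\to[0,1]$, with degree function $d_g(x)=\int_0^1g(x,y)\,dy$. Densities: $t_1(g)=\int g(x,y)\,dx\,dy$, $t_2(g)=\int_0^1 d_g(x)^2dx$, $\tilde t_3(g)=\int g(w,x)g(x,y)g(y,z)\,dw\,dx\,dy\,dz$, $\tilde t_4(g)=\int g(w,x)g(x,y)g(y,z)g(z,w)\,dw\,dx\,dy\,dz$. The triangle graphon is $g_T(x,y)=1$ if $x+y>1$ and $0$ if $x+y<1$, and $g_\alpha=\alpha+(1-2\alpha)g_T$ for $0\le\alpha\le1/2$. A graphon is $M$-podal if there is a partition of $[0,1]$ into at most $M$ measurable sets $V_1,\dots,V_m$ such that $g$ is almost everywhere constant on each $V_i\times V_j$. (Known fact used in the paper: $g_T$ is finitely forcible, i.e. any graphon $g$ with $t_1(g)-t_2(g)\ge 1/6$ and $t_1(g)^2-2\tilde t_3(g)+\tilde t_4(g)=0$ is equivalent to $g_T$.) *)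

theory Defs
  imports "HOL-Analysis.Analysis"
begin

definition I01 :: "real measure" where
  "I01 = restrict_space lborel {0..1}"

definition graphon :: "(real \<Rightarrow> real \<Rightarrow> real) \<Rightarrow> bool" where
  "graphon g \<longleftrightarrow>
     (\<lambda>p. g (fst p) (snd p)) \<in> borel_measurable (I01 \<Otimes>\<^sub>M I01) \<and>
     (\<forall>x\<in>{0..1}. \<forall>y\<in>{0..1}. g x y = g y x \<and> 0 \<le> g x y \<and> g x y \<le> 1)"

definition degree :: "(real \<Rightarrow> real \<Rightarrow> real) \<Rightarrow> real \<Rightarrow> real" where
  "degree g x = (\<integral>y. g x y \<partial>I01)"

definition t1 :: "(real \<Rightarrow> real \<Rightarrow> real) \<Rightarrow> real" where
  "t1 g = (\<integral>x. (\<integral>y. g x y \<partial>I01) \<partial>I01)"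

definition t2 :: "(real \<Rightarrow> real \<Rightarrow> real) \<Rightarrow> real" where
  "t2 g = (\<integral>x. (degree g x)\<^sup>2 \<partial>I01)"

definition t3 :: "(real \<Rightarrow> real \<Rightarrow> real) \<Rightarrow> real" where
  "t3 g = (\<integral>w. (\<integral>x. (\<integral>y. (\<integral>z. g w x * g x y * g y z \<partial>I01) \<partial>I01) \<partial>I01) \<partial>I01)"

definition t4 :: "(real \<Rightarrow> real \<Rightarrow> real) \<Rightarrow> real" where
  "t4 g = (\<integral>w. (\<integral>x. (\<integral>y. (\<integral>z. g w x * g x y * g y z * g z w \<partial>I01) \<partial>I01) \<partial>I01) \<partial>I01)"

text \<open>Triangle graphon (value on the null set x+y=1 chosen as 0).\<close>
definition gT :: "real \<Rightarrow> real \<Rightarrow> real" where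
  "gT x y = (if x + y > 1 then 1 else 0)"

definition galpha :: "real \<Rightarrow> real \<Rightarrow> real \<Rightarrow> real" where
  "galpha \<alpha> x y = \<alpha> + (1 - 2 * \<alpha>) * gT x y"

definition podal :: "nat \<Rightarrow> (real \<Rightarrow> real \<Rightarrow> real) \<Rightarrow> bool" where
  "podal M g \<longleftrightarrow> (\<exists>m\<le>M. \<exists>V :: nat \<Rightarrow> real set.
     (\<forall>i<m. V i \<in> sets I01) \<and> (\<Union>i<m. V i) = {0..1} \<and> disjoint_family_on V {..<m} \<and>
     (\<forall>i<m. \<forall>j<m. \<exists>c. AE p in I01 \<Otimes>\<^sub>M I01.
         p \<in> V i \<times> V j \<longrightarrow> g (fst p) (snd p) = c))"

end

theory Submission
  imports Defs
begin

text \<open>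
  Expanding the integrand shows that \<open>t1\<^sup>2 - 2 t3 + t4\<close> is the integral of
  \<open>g(w,x) g(y,z) (1 - g(x,y)) (1 - g(z,w))\<close>. For \<open>g\<^sub>\<alpha>\<close> one of the four factors is always \<open>\<alpha>\<close>, so this
  is at most \<open>\<alpha>\<close>, while \<open>t1 - t2 \<ge> 1/6\<close>. An \<open>M\<close>-podal graphon is given by weights and values in a
  compact set on which both quantities are continuous, so it suffices that an \<open>M\<close>-podal graphon for
  which the integral vanishes has \<open>t1 - t2 < 1/6\<close>. Vanishing forces the values on blocks of positive
  measure to be 0 or 1 and the neighbourhoods to be nested. Ordering the blocks by decreasing degree,
  \<open>t1 - t2\<close> becomes the integral of \<open>1 - x - y\<close> over a union of cells of a grid, which is less than
  the integral \<open>1/6\<close> of its positive part, because the cell at the corner \<open>(0,1)\<close> is cut by the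
  antidiagonal.
\<close>

subsection \<open>Threshold step functions\<close>

text \<open>\<open>max 0 t ^ 3\<close> has second derivative \<open>6 * max 0 t\<close>, so this
  mixed difference is the integral of \<open>6 * max 0 (s + u + v)\<close> over a \<open>p\<close>
  by \<open>q\<close> rectangle. For \<open>s < 0\<close> superadditivity of the cube replaces the
  integral.\<close>

lemma cube_mixed_difference_pos:
  fixes s p q :: real
  assumes "p > 0" "q > 0" "s + p + q > 0"
  shows "0 < max 0 (s + p + q) ^ 3 - max 0 (s + p) ^ 3 - max 0 (s + q) ^ 3 + max 0 s ^ 3"
proof (cases "s \<ge> 0")
  case True
  have "(s + p + q) ^ 3 - (s + p) ^ 3 - (s + q) ^ 3 + s ^ 3 = 3 * p * q * (2 * s + p + q)"
    by (simp add: power3_eq_cube algebra_simps)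
  also have "\<dots> > 0" using assms True by (intro mult_pos_pos) auto
  finally show ?thesis using assms True by simp
next
  case False
  define x y z where "x = max 0 (s + p)" "y = max 0 (s + q)" "z = s + p + q"
  have nn: "x \<ge> 0" "y \<ge> 0" by (auto simp: x_y_z_def)
  \<comment> \<open>\<open>x + y\<close> is the maximum of 0, \<open>s + p\<close>,
    \<open>s + q\<close> and \<open>2 * s + p + q\<close>, each below \<open>z\<close> because
    \<open>s < 0\<close>.\<close>
  have lt: "x + y < z" using False assms by (auto simp: x_y_z_def max_def)
  have "(x + y) ^ 3 - x ^ 3 - y ^ 3 = 3 * x * y * (x + y)"
    by (simp add: power3_eq_cube algebra_simps)
  also have "\<dots> \<ge> 0" using nn by simp
  finally have "x ^ 3 + y ^ 3 \<le> (x + y) ^ 3" by simp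
  also have "\<dots> < z ^ 3" using lt nn by (intro power_strict_mono) auto
  finally show ?thesis using False assms by (simp add: x_y_z_def)
qed

lemma cube_mixed_difference_nonneg:
  fixes s p q :: real
  assumes "p > 0" "q > 0"
  shows "0 \<le> max 0 (s + p + q) ^ 3 - max 0 (s + p) ^ 3 - max 0 (s + q) ^ 3 + max 0 s ^ 3"
proof (cases "s + p + q > 0")
  case True
  then show ?thesis using cube_mixed_difference_pos[of p q s] assms by simp
next
  case False
  then show ?thesis using assms by (simp add: max_def)
qed

lemma max_0_cube_minus_cube: "max 0 t ^ 3 - t ^ 3 = max 0 (- t) ^ 3" for t :: real
  by (auto simp: max_def)

text \<open>The subtracted polynomial is the mixed difference of \<open>t ^ 3\<close>. Removing it
  turns each positive part into a negative part, so what remains is the mixed difference of the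
  reflected cell.\<close>

lemma cube_mixed_difference_reflect:
  fixes s p q :: real
  shows "max 0 (s + p + q) ^ 3 - max 0 (s + p) ^ 3 - max 0 (s + q) ^ 3 + max 0 s ^ 3
      - 6 * p * q * (s + (p + q) / 2)
    = max 0 (- s) ^ 3 - max 0 (- (s + p)) ^ 3 - max 0 (- (s + q)) ^ 3 + max 0 (- (s + p + q)) ^ 3"
proof -
  have "(s + p + q) ^ 3 - (s + p) ^ 3 - (s + q) ^ 3 + s ^ 3 = 6 * p * q * (s + (p + q) / 2)"
    by (simp add: power3_eq_cube field_simps)
  then show ?thesis
    by (simp only: max_0_cube_minus_cube[symmetric] minus_minus)
qed

text \<open>The right-hand side is six times the integral of \<open>max 0 (1 - x - y)\<close> over a rectangle with
  sides \<open>p\<close>, \<open>q\<close> whose upper right corner has \<open>1 - x - y = s\<close>; this is Jensen's inequality without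
  integrals.\<close>
lemma cell_bound:
  fixes s p q a :: real
  assumes "p > 0" "q > 0" "a = 0 \<or> a = 1"
  shows "6 * p * q * a * (s + (p + q) / 2)
    \<le> max 0 (s + p + q) ^ 3 - max 0 (s + p) ^ 3 - max 0 (s + q) ^ 3 + max 0 s ^ 3" (is ?le)
    and "s < 0 \<Longrightarrow> s + p + q > 0 \<Longrightarrow> 6 * p * q * a * (s + (p + q) / 2)
    < max 0 (s + p + q) ^ 3 - max 0 (s + p) ^ 3 - max 0 (s + q) ^ 3 + max 0 s ^ 3" (is "PROP ?A \<Longrightarrow> PROP ?B \<Longrightarrow> ?lt")
proof -
  \<comment> \<open>The reflected cell has its base at \<open>- (s + p + q)\<close>; these
    identities bring the sign lemmas there into the form of \<open>r\<close>.\<close>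
  have eq: "- (s + p + q) + p = - (s + q)" "- (s + p + q) + q = - (s + p)" "- (s + q) + q = - s"
    by auto
  note r = cube_mixed_difference_reflect[of s p q]
  define D where "D = max 0 (s + p + q) ^ 3 - max 0 (s + p) ^ 3 - max 0 (s + q) ^ 3 + max 0 s ^ 3"
  define E where "E = 6 * p * q * (s + (p + q) / 2)"
  have D: "D \<ge> 0" "s + p + q > 0 \<Longrightarrow> D > 0"
    unfolding D_def using cube_mixed_difference_nonneg cube_mixed_difference_pos assms by auto
  have "D - E = max 0 (- s) ^ 3 - max 0 (- (s + p)) ^ 3 - max 0 (- (s + q)) ^ 3
      + max 0 (- (s + p + q)) ^ 3"
    unfolding D_def E_def by (rule r)
  then have DE: "D - E \<ge> 0" "s < 0 \<Longrightarrow> D - E > 0"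
    using cube_mixed_difference_nonneg[of p q "- (s + p + q)", unfolded eq]
      cube_mixed_difference_pos[of p q "- (s + p + q)", unfolded eq] assms by linarith+
  \<comment> \<open>The claim compares \<open>a * E\<close> with \<open>D\<close>: the case
    \<open>a = 0\<close> is the sign of \<open>D\<close>, the case \<open>a = 1\<close> that of
    \<open>D - E\<close>.\<close>
  have "6 * p * q * a * (s + (p + q) / 2) = a * E" by (simp add: E_def)
  with D DE assms(3) show ?le "s < 0 \<Longrightarrow> s + p + q > 0 \<Longrightarrow> ?lt"
    unfolding D_def[symmetric] by auto
qed

text \<open>\<open>f\<close> is the indicator of an initial segment, and \<open>p k\<close> times
  the sum of the two adjacent partial sums is the difference of their squares, so the right-hand
  side telescopes.\<close>

lemma square_sum_initial_segment:
  fixes p f :: "nat \<Rightarrow> real"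
  assumes "\<And>k. k < n \<Longrightarrow> f k = 0 \<or> f k = 1" and "\<And>k l. k \<le> l \<Longrightarrow> l < n \<Longrightarrow> f l \<le> f k"
  shows "(\<Sum>k<n. p k * f k)\<^sup>2 = (\<Sum>k<n. p k * f k * ((\<Sum>l<k. p l) + (\<Sum>l<Suc k. p l)))"
  using assms
proof (induction n)
  case (Suc n)
  have IH: "(\<Sum>k<n. p k * f k)\<^sup>2 = (\<Sum>k<n. p k * f k * ((\<Sum>l<k. p l) + (\<Sum>l<Suc k. p l)))"
    by (rule Suc.IH) (use Suc.prems in auto)
  have "f n = 0 \<or> f n = 1" using Suc.prems(1) by auto
  then show ?case
  proof
    assume "f n = 0"
    then show ?thesis using IH by simp
  next
    assume 1: "f n = 1"
    have "f k = 1" if "k < n" for k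
      using Suc.prems(1)[of k] Suc.prems(2)[of k n] that 1 by fastforce
    then have "(\<Sum>k<n. p k * f k) = (\<Sum>k<n. p k)" by simp
    then show ?thesis using IH 1 by (simp add: power2_eq_square algebra_simps)
  qed
qed simp

text \<open>\<open>noalt\<close> excludes alternating 4-cycles, so \<open>a\<close> is the matrix of
  a threshold graph with loops. By \<open>sorted\<close>, the nesting of neighbourhoods follows the
  index order, and the blocks can be laid out along the unit interval.\<close>

lemma sorted_threshold_bound:
  fixes n :: nat and p :: "nat \<Rightarrow> real" and a :: "nat \<Rightarrow> nat \<Rightarrow> real"
  defines "d \<equiv> \<lambda>i. \<Sum>j<n. p j * a i j"
  assumes pos: "\<And>i. i < n \<Longrightarrow> p i > 0" and total: "(\<Sum>i<n. p i) = 1"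
    and sym: "\<And>i j. i < n \<Longrightarrow> j < n \<Longrightarrow> a i j = a j i"
    and noalt: "\<And>w x y z. w < n \<Longrightarrow> x < n \<Longrightarrow> y < n \<Longrightarrow> z < n \<Longrightarrow>
                  a w x * a y z * (1 - a x y) * (1 - a z w) = 0"
    and sorted: "\<And>i j. i \<le> j \<Longrightarrow> j < n \<Longrightarrow> d j \<le> d i"
  shows "(\<Sum>i<n. p i * (d i - (d i)\<^sup>2)) < 1 / 6"
proof -
  have n: "n > 0" using total by (cases n) auto
  \<comment> \<open>The degenerate cycle \<open>i, j, i, j\<close> gives
    \<open>(a i j)\<^sup>2 * (1 - a i j)\<^sup>2 = 0\<close>.\<close>
  have a01: "a i j = 0 \<or> a i j = 1" if "i < n" "j < n" for i j
    using noalt[of i j i j] sym[of i j] that by auto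
  \<comment> \<open>If \<open>j\<close> sees some \<open>k\<close> that \<open>i\<close> misses,
    then \<open>d j \<le> d i\<close> forces \<open>i\<close> to see some \<open>l\<close> that
    \<open>j\<close> misses, and \<open>k, j, l, i\<close> is an alternating cycle.\<close>
  have mono: "a j k \<le> a i k" if ij: "i \<le> j" "j < n" "k < n" for i j k
  proof (rule ccontr)
    assume "\<not> a j k \<le> a i k"
    then have jk: "a j k = 1" and ik: "a i k = 0"
      using a01[of j k] a01[of i k] ij by auto
    have "\<exists>l<n. \<not> a i l \<le> a j l"
    proof (rule ccontr)
      assume "\<not> (\<exists>l<n. \<not> a i l \<le> a j l)"
      then have "d i < d j" unfolding d_def
        using ij jk ik pos
        by (intro sum_strict_mono_strong[of _ k]) (auto intro!: mult_left_mono simp: less_imp_le)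
      then show False using sorted[OF ij(1,2)] by simp
    qed
    then obtain l where l: "l < n" "a i l = 1" "a j l = 0"
      using a01[of i _] a01[of j _] ij by (metis le_less_trans order_refl zero_le_one)
    show False
      using noalt[of k j l i] l jk ik ij sym[of k j] sym[of l i] by auto
  qed
  define P where "P k = (\<Sum>l<k. p l)" for k
  have PS: "P (Suc k) = P k + p k" for k by (simp add: P_def)
  have P0: "P 0 = 0" and Pn: "P n = 1" using total by (auto simp: P_def)
  have sq: "(d i)\<^sup>2 = (\<Sum>j<n. p j * a i j * (P j + P (Suc j)))" if "i < n" for i
    unfolding d_def P_def
  proof (rule square_sum_initial_segment)
    show "a i l \<le> a i k" if "k \<le> l" "l < n" for k l
      using mono[OF that \<open>i < n\<close>] sym[of i l] sym[of i k] that \<open>i < n\<close> by auto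
  qed (rule a01[OF that])
  \<comment> \<open>Neighbourhoods are initial segments, so \<open>d\<^sup>2\<close> is a sum of midranks over a neighbourhood;
    symmetrising, \<open>G\<close> is the sum of \<open>p i * p j * a i j * (1 - r i - r j)\<close> with midranks \<open>r\<close>.\<close>
  define Q where "Q i j = p i * p j * a i j" for i j
  have Qsym: "Q i j = Q j i" if "i < n" "j < n" for i j
    using sym[OF that] by (simp add: Q_def)
  define G where "G = (\<Sum>i<n. p i * (d i - (d i)\<^sup>2))"
  have "d i - (d i)\<^sup>2 = (\<Sum>j<n. p j * a i j * (1 - P j - P (Suc j)))" if "i < n" for i
    unfolding sq[OF that]
    unfolding d_def sum_subtractf[symmetric]
    by (intro sum.cong refl) (simp add: algebra_simps)
  then have G1: "G = (\<Sum>i<n. \<Sum>j<n. Q i j * (1 - P j - P (Suc j)))"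
    unfolding G_def
    by (intro sum.cong refl) (simp add: Q_def sum_distrib_left mult.assoc)
  also have "\<dots> = (\<Sum>j<n. \<Sum>i<n. Q i j * (1 - P j - P (Suc j)))"
    by (rule sum.swap)
  also have "\<dots> = (\<Sum>i<n. \<Sum>j<n. Q i j * (1 - P i - P (Suc i)))"
    by (intro sum.cong refl) (simp add: Qsym)
  finally have G2: "G = (\<Sum>i<n. \<Sum>j<n. Q i j * (1 - P i - P (Suc i)))" .
  \<comment> \<open>The value of \<open>1 - x - y\<close> at the upper right corner of cell
    \<open>(i, j)\<close>; adding \<open>(p i + p j) / 2\<close> gives the value at its
    centre.\<close>
  define s where "s i j = 1 - P (Suc i) - P (Suc j)" for i j
  have "6 * G = 3 * (G + G)" by simp
  also have "\<dots> = 3 * ((\<Sum>i<n. \<Sum>j<n. Q i j * (1 - P j - P (Suc j)))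
      + (\<Sum>i<n. \<Sum>j<n. Q i j * (1 - P i - P (Suc i))))"
    using G1 G2 by simp
  also have "\<dots> = (\<Sum>i<n. \<Sum>j<n. 6 * p i * p j * a i j * (s i j + (p i + p j) / 2))"
    unfolding sum.distrib[symmetric] sum_distrib_left
    by (intro sum.cong refl) (simp add: Q_def s_def PS field_simps)
  finally have G6: "6 * G = \<dots>" .
  define \<psi> :: "real \<Rightarrow> real" where "\<psi> t = max 0 t ^ 3" for t
  \<comment> \<open>Six times the integral of the positive part of \<open>1 - x - y\<close> over
    cell \<open>(i, j)\<close>, in a form that telescopes in both indices.\<close>
  define \<Delta> where "\<Delta> i j = \<psi> (1 - P i - P j) - \<psi> (1 - P i - P (Suc j))
    - \<psi> (1 - P (Suc i) - P j) + \<psi> (1 - P (Suc i) - P (Suc j))" for i j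
  have \<Delta>: "\<Delta> i j = max 0 (s i j + p i + p j) ^ 3 - max 0 (s i j + p i) ^ 3
      - max 0 (s i j + p j) ^ 3 + max 0 (s i j) ^ 3" for i j
    by (simp add: \<Delta>_def \<psi>_def s_def PS algebra_simps)
  have le: "6 * p i * p j * a i j * (s i j + (p i + p j) / 2) \<le> \<Delta> i j" if "i < n" "j < n" for i j
    unfolding \<Delta> using that pos a01 by (intro cell_bound) auto
  obtain m where m: "n = Suc m" using n by (cases n) auto
  \<comment> \<open>The cell at the corner \<open>(0,1)\<close> meets both sides of the antidiagonal.\<close>
  have lt: "6 * p 0 * p m * a 0 m * (s 0 m + (p 0 + p m) / 2) < \<Delta> 0 m"
    unfolding \<Delta> using n m pos[of 0] pos[of m] a01[of 0 m] Pn P0 PS[of 0] PS[of m]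
    by (intro cell_bound) (auto simp: s_def)
  have tele: "(\<Sum>j<n. \<Delta> i j) = (\<psi> (1 - P i - P 0) - \<psi> (1 - P i - P n))
      - (\<psi> (1 - P (Suc i) - P 0) - \<psi> (1 - P (Suc i) - P n))" for i
    using sum_lessThan_telescope'[of "\<lambda>j. \<psi> (1 - P i - P j)" n]
      sum_lessThan_telescope'[of "\<lambda>j. \<psi> (1 - P (Suc i) - P j)" n]
    by (simp add: \<Delta>_def sum_subtractf sum.distrib algebra_simps)
  have "6 * G < (\<Sum>i<n. \<Sum>j<n. \<Delta> i j)"
    unfolding G6
  proof (rule sum_strict_mono_strong[of _ 0])
    show "(\<Sum>j<n. 6 * p 0 * p j * a 0 j * (s 0 j + (p 0 + p j) / 2)) < (\<Sum>j<n. \<Delta> 0 j)"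
      by (rule sum_strict_mono_strong[of _ m]) (use le n m lt in auto)
    show "(\<Sum>j<n. 6 * p i * p j * a i j * (s i j + (p i + p j) / 2)) \<le> (\<Sum>j<n. \<Delta> i j)"
      if "i \<in> {..<n}" for i
      by (rule sum_mono) (use le that in blast)
  qed (use n in simp_all)
  \<comment> \<open>Of the four corners of the unit square only \<open>(0, 0)\<close> contributes,
    with \<open>\<psi> 1 = 1\<close>.\<close>
  also have "\<dots> = 1"
    unfolding tele
    using sum_lessThan_telescope'[of "\<lambda>i. \<psi> (1 - P i - P 0) - \<psi> (1 - P i - P n)" n]
    by (simp add: P0 Pn \<psi>_def)
  finally show ?thesis by (simp add: G_def)
qed

subsection \<open>The compact set of step data\<close>

text \<open>The alternating 4-cycle integral of the step graphon with block weights \<open>p\<close>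
  and values \<open>a\<close>. Each level has the shape \<open>p i * f i\<close>, so one integration
  formula serves all four variables.\<close>

definition alt4 :: "nat \<Rightarrow> (nat \<Rightarrow> real) \<Rightarrow> (nat \<Rightarrow> nat \<Rightarrow> real) \<Rightarrow> real" where
  "alt4 M p a = (\<Sum>w<M. p w * (\<Sum>x<M. p x * (\<Sum>y<M. p y * (\<Sum>z<M. p z *
     (a w x * a y z * (1 - a x y) * (1 - a z w))))))"

text \<open>The value of \<open>t1 - t2\<close> for the same step graphon; the inner sums are block
  degrees.\<close>

definition degvar :: "nat \<Rightarrow> (nat \<Rightarrow> real) \<Rightarrow> (nat \<Rightarrow> nat \<Rightarrow> real) \<Rightarrow> real" where
  "degvar M p a = (\<Sum>i<M. p i * ((\<Sum>j<M. p j * a i j) - (\<Sum>j<M. p j * a i j)\<^sup>2))"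

text \<open>The values of \<open>p\<close> and \<open>a\<close> at indices \<open>\<ge> M\<close> are irrelevant, but bounding them keeps the set
  compact in the product topology.\<close>
definition step_data :: "nat \<Rightarrow> ((nat \<Rightarrow> real) \<times> (nat \<Rightarrow> nat \<Rightarrow> real)) set" where
  "step_data M = {(p, a). (\<forall>i. p i \<in> {0..1}) \<and> (\<forall>i j. a i j \<in> {0..1})
     \<and> (\<Sum>i<M. p i) = 1 \<and> (\<forall>i j. a i j = a j i)}"

lemma alt4_nonneg:
  assumes "(p, a) \<in> step_data M"
  shows "alt4 M p a \<ge> 0"
proof -
  have p: "p i \<ge> 0" and a: "a i j \<ge> 0" "1 - a i j \<ge> 0" for i j
    using assms by (auto simp: step_data_def)
  show ?thesis
    unfolding alt4_def by (intro sum_nonneg mult_nonneg_nonneg p a)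
qed

lemma alt4_eq_0_pointwise:
  assumes "(p, a) \<in> step_data M" "alt4 M p a = 0"
    and "w < M" "x < M" "y < M" "z < M" "p w > 0" "p x > 0" "p y > 0" "p z > 0"
  shows "a w x * a y z * (1 - a x y) * (1 - a z w) = 0"
proof -
  have p: "p i \<ge> 0" and a: "a i j \<ge> 0" "a i j \<le> 1" for i j
    using assms(1) by (auto simp: step_data_def)
  have nn: "a w x * a y z * (1 - a x y) * (1 - a z w) \<ge> 0" for w x y z
    using a by simp
  note sn = sum_nonneg mult_nonneg_nonneg p nn
  have "p w * (\<Sum>x<M. p x * (\<Sum>y<M. p y * (\<Sum>z<M. p z *
     (a w x * a y z * (1 - a x y) * (1 - a z w))))) = 0"
    using assms(2,3) unfolding alt4_def
    by (subst (asm) sum_nonneg_eq_0_iff) (auto intro!: sn simp del: mult_eq_0_iff)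
  then have "(\<Sum>x<M. p x * (\<Sum>y<M. p y * (\<Sum>z<M. p z *
     (a w x * a y z * (1 - a x y) * (1 - a z w))))) = 0" using assms by simp
  then have "p x * (\<Sum>y<M. p y * (\<Sum>z<M. p z *
     (a w x * a y z * (1 - a x y) * (1 - a z w)))) = 0"
    using assms(4)
    by (subst (asm) sum_nonneg_eq_0_iff) (auto intro!: sn simp del: mult_eq_0_iff)
  then have "(\<Sum>y<M. p y * (\<Sum>z<M. p z *
     (a w x * a y z * (1 - a x y) * (1 - a z w)))) = 0" using assms by simp
  then have "p y * (\<Sum>z<M. p z *
     (a w x * a y z * (1 - a x y) * (1 - a z w))) = 0"
    using assms(5)
    by (subst (asm) sum_nonneg_eq_0_iff) (auto intro!: sn simp del: mult_eq_0_iff)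
  then have "(\<Sum>z<M. p z * (a w x * a y z * (1 - a x y) * (1 - a z w))) = 0" using assms by simp
  then have "p z * (a w x * a y z * (1 - a x y) * (1 - a z w)) = 0"
    using assms(6)
    by (subst (asm) sum_nonneg_eq_0_iff) (auto intro!: sn simp del: mult_eq_0_iff)
  then show ?thesis using assms by simp
qed

text \<open>Blocks of weight 0 are discarded, since a vanishing \<open>alt4\<close> says nothing
  about the values there; the others are listed by decreasing degree.\<close>

lemma degvar_less:
  assumes S: "(p, a) \<in> step_data M" and Z: "alt4 M p a = 0"
  shows "degvar M p a < 1 / 6"
proof -
  define d where "d i = (\<Sum>j<M. p j * a i j)" for i
  define I where "I = {i. i < M \<and> p i > 0}"
  define xs where "xs = sort_key (\<lambda>i. - d i) (sorted_list_of_set I)"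
  define n where "n = length xs"
  have p: "p i \<ge> 0" for i using S by (auto simp: step_data_def)
  have fin: "finite I" by (simp add: I_def)
  have set: "set xs = I" and dist: "distinct xs" using fin by (auto simp: xs_def)
  have bij: "bij_betw ((!) xs) {..<n} I"
    by (rule bij_betw_nth) (use set dist in \<open>auto simp: n_def\<close>)
  \<comment> \<open>Null blocks do not change weighted sums; this transfers the degrees, the total
    weight and \<open>degvar\<close> to the list.\<close>
  have reindex: "(\<Sum>i<M. p i * f i) = (\<Sum>k<n. p (xs ! k) * f (xs ! k))" for f :: "nat \<Rightarrow> real"
  proof -
    have "(\<Sum>i<M. p i * f i) = (\<Sum>i\<in>I. p i * f i)"
      by (rule sum.mono_neutral_right) (use p in \<open>auto simp: I_def order.order_iff_strict\<close>)
    also have "\<dots> = (\<Sum>k<n. p (xs ! k) * f (xs ! k))"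
      using sum.reindex_bij_betw[OF bij, of "\<lambda>i. p i * f i"] by simp
    finally show ?thesis .
  qed
  have inI: "xs ! k < M" "p (xs ! k) > 0" if "k < n" for k
    using that set nth_mem[of k xs] by (auto simp: n_def I_def)
  have d: "d i = (\<Sum>k<n. p (xs ! k) * a i (xs ! k))" for i
    unfolding d_def by (rule reindex)
  have "sorted (map (\<lambda>i. - d i) xs)" by (simp add: xs_def)
  then have srt: "d (xs ! j) \<le> d (xs ! i)" if "i \<le> j" "j < n" for i j
    using that by (auto simp: sorted_iff_nth_mono n_def)
  have "degvar M p a = (\<Sum>k<n. p (xs ! k) * (d (xs ! k) - (d (xs ! k))\<^sup>2))"
    unfolding degvar_def d_def[symmetric] by (rule reindex)
  also have "\<dots> < 1 / 6"
    unfolding d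
  proof (rule sorted_threshold_bound)
    show "(\<Sum>i<n. p (xs ! i)) = 1"
      using reindex[of "\<lambda>_. 1"] S by (simp add: step_data_def)
    show "a (xs ! i) (xs ! j) = a (xs ! j) (xs ! i)" for i j
      using S by (simp add: step_data_def)
    show "a (xs ! w) (xs ! x) * a (xs ! y) (xs ! z) * (1 - a (xs ! x) (xs ! y)) *
       (1 - a (xs ! z) (xs ! w)) = 0" if "w < n" "x < n" "y < n" "z < n" for w x y z
      by (intro alt4_eq_0_pointwise[OF S Z] inI that)
    show "(\<Sum>k<n. p (xs ! k) * a (xs ! j) (xs ! k)) \<le> (\<Sum>k<n. p (xs ! k) * a (xs ! i) (xs ! k))"
      if "i \<le> j" "j < n" for i j
      using srt[OF that] unfolding d .
  qed (rule inI)
  finally show ?thesis .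
qed

lemma continuous_on_coordinates [continuous_intros]:
  shows "continuous_on S (\<lambda>q :: (nat \<Rightarrow> real) \<times> (nat \<Rightarrow> nat \<Rightarrow> real). fst q i)"
    and "continuous_on S (\<lambda>q :: (nat \<Rightarrow> real) \<times> (nat \<Rightarrow> nat \<Rightarrow> real). snd q i j)"
  by (rule continuous_on_product_then_coordinatewise, intro continuous_intros)
    (rule continuous_on_product_then_coordinatewise,
      rule continuous_on_product_then_coordinatewise, intro continuous_intros)

text \<open>Tychonoff for the box; total weight 1 and symmetry are closed conditions.\<close>

lemma compact_step_data: "compact (step_data M)"
proof -
  let ?B = "(UNIV \<rightarrow>\<^sub>E {0..1 :: real}) \<times> (UNIV \<rightarrow>\<^sub>E (UNIV \<rightarrow>\<^sub>E {0..1 :: real})) :: ((nat \<Rightarrow> real) \<times> (nat \<Rightarrow> nat \<Rightarrow> real)) set"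
  let ?C = "{q :: (nat \<Rightarrow> real) \<times> (nat \<Rightarrow> nat \<Rightarrow> real). (\<Sum>i<M. fst q i) = 1}
    \<inter> (\<Inter>i. \<Inter>j. {q. snd q i j = snd q j i})"
  have "compact ?B"
    using compactin_PiE[of "\<lambda>_. euclidean" "UNIV :: nat set" "\<lambda>_. {0..1 :: real}"]
      compactin_PiE[of "\<lambda>_. euclidean" "UNIV :: nat set" "\<lambda>_. UNIV \<rightarrow>\<^sub>E {0..1 :: real} :: (nat \<Rightarrow> real) set"]
    by (intro compact_Times) (simp_all add: euclidean_product_topology)
  moreover have "closed ?C"
    by (intro closed_Int closed_INT ballI closed_Collect_eq continuous_intros)
  moreover have "step_data M = ?B \<inter> ?C"
    by (auto simp: step_data_def PiE_def Pi_def)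
  ultimately show ?thesis by (simp add: compact_Int_closed)
qed

lemma step_data_gap:
  obtains \<epsilon> where "\<epsilon> > 0"
    "\<And>p a. (p, a) \<in> step_data M \<Longrightarrow> degvar M p a \<ge> 1 / 6 \<Longrightarrow> alt4 M p a \<ge> \<epsilon>"
proof (cases "step_data M = {}")
  \<comment> \<open>This happens for \<open>M = 0\<close>, where the empty sum cannot be 1.\<close>
  case True
  then show ?thesis using that[of 1] by auto
next
  case False
  \<comment> \<open>The penalty vanishes once \<open>degvar\<close> reaches 1/6 and is positive
    where \<open>alt4\<close> is 0, so \<open>\<phi>\<close> is positive everywhere and its minimum
    serves as \<open>\<epsilon>\<close>.\<close>
  define \<phi> where "\<phi> q = alt4 M (fst q) (snd q) + max 0 (1 / 6 - degvar M (fst q) (snd q))" for q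
  have "continuous_on (step_data M) \<phi>"
    unfolding \<phi>_def alt4_def degvar_def by (intro continuous_intros)
  then obtain q where q: "q \<in> step_data M" and min: "\<And>r. r \<in> step_data M \<Longrightarrow> \<phi> q \<le> \<phi> r"
    using continuous_attains_inf[OF compact_step_data False] by blast
  have "\<phi> q > 0"
    using alt4_nonneg[of "fst q" "snd q" M] degvar_less[of "fst q" "snd q" M] q
    by (cases "alt4 M (fst q) (snd q) = 0") (auto simp: \<phi>_def)
  then show ?thesis
    proof (rule that)
    show "\<phi> q \<le> alt4 M p a" if "(p, a) \<in> step_data M" "degvar M p a \<ge> 1 / 6" for p a
      using min[OF that(1)] that(2) by (simp add: \<phi>_def[of "(p, a)"])
  qed
qed

subsection \<open>Integrals over the unit interval\<close>

lemma space_I01 [simp]: "space I01 = {0..1}"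
  by (simp add: I01_def space_restrict_space)

lemma measure_I01_space: "measure I01 {0..1} = 1"
  by (simp add: I01_def measure_restrict_space)

interpretation I01: finite_measure I01
  by (rule finite_measureI) (simp add: I01_def space_restrict_space emeasure_restrict_space)

interpretation I01: pair_sigma_finite I01 I01 ..

lemma integral_I01_cong:
  "(\<And>x. x \<in> {0..1} \<Longrightarrow> f x = h x) \<Longrightarrow> (\<integral>x. f x \<partial>I01) = (\<integral>x. h x \<partial>I01)"
  by (rule Bochner_Integration.integral_cong) auto

lemma integrable_I01:
  assumes "f \<in> borel_measurable I01" "\<And>x. x \<in> {0..1} \<Longrightarrow> \<bar>f x\<bar> \<le> C"
  shows "integrable I01 (f :: real \<Rightarrow> real)"
  by (rule I01.integrable_const_bound[where B = C]) (use assms in \<open>auto intro!: AE_I2\<close>)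

text \<open>\<open>C \<ge> 0\<close> replaces integrability: the integral of a non-integrable
  function is 0.\<close>

lemma integral_I01_le:
  assumes "C \<ge> 0" "\<And>x. x \<in> {0..1} \<Longrightarrow> f x \<le> C"
  shows "(\<integral>x. f x \<partial>I01) \<le> (C :: real)"
proof (cases "integrable I01 f")
  case True
  have "(\<integral>x. f x \<partial>I01) \<le> (\<integral>x. C \<partial>I01)"
    by (intro integral_mono True) (use assms in auto)
  then show ?thesis by (simp add: measure_I01_space)
next
  case False
  then show ?thesis using assms by (simp add: not_integrable_integral_eq)
qed

lemma integral_I01_nonneg: "(\<And>x. x \<in> {0..1} \<Longrightarrow> f x \<ge> 0) \<Longrightarrow> (\<integral>x. f x \<partial>I01) \<ge> (0 :: real)"
  by (intro Bochner_Integration.integral_nonneg) simp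

lemma Fubini_I01:
  fixes f :: "real \<Rightarrow> real \<Rightarrow> real"
  assumes "(\<lambda>q. f (fst q) (snd q)) \<in> borel_measurable (I01 \<Otimes>\<^sub>M I01)"
    and "\<And>x y. x \<in> {0..1} \<Longrightarrow> y \<in> {0..1} \<Longrightarrow> \<bar>f x y\<bar> \<le> C"
  shows "(\<integral>x. (\<integral>y. f x y \<partial>I01) \<partial>I01) = (\<integral>y. (\<integral>x. f x y \<partial>I01) \<partial>I01)"
proof -
  interpret P: finite_measure "I01 \<Otimes>\<^sub>M I01"
    by (intro finite_measure_pair_measure I01.finite_measure_axioms)
  have "integrable (I01 \<Otimes>\<^sub>M I01) (case_prod f)"
    by (rule P.integrable_const_bound[where B = C])
      (use assms in \<open>auto intro!: AE_I2 simp: space_pair_measure case_prod_beta\<close>)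
  then show ?thesis using I01.Fubini_integral by metis
qed

text \<open>With arbitrary argument maps the rule applies to every occurrence of \<open>g\<close>
  under nested integrals.\<close>

lemma graphon_measurable:
  assumes "graphon g" "f \<in> N \<rightarrow>\<^sub>M I01" "h \<in> N \<rightarrow>\<^sub>M I01"
  shows "(\<lambda>x. g (f x) (h x)) \<in> borel_measurable N"
  using measurable_compose[OF measurable_Pair[OF assms(2,3)], of "\<lambda>q. g (fst q) (snd q)" borel] assms(1)
  by (simp add: graphon_def)

lemma graphonD:
  assumes "graphon g" "x \<in> {0..1}" "y \<in> {0..1}"
  shows "g x y = g y x" "0 \<le> g x y" "g x y \<le> 1"
  using assms by (auto simp: graphon_def)

section \<open>The density of alternating 4-cycles\<close>

definition alt_int :: "(real \<Rightarrow> real \<Rightarrow> real) \<Rightarrow> real" where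
  "alt_int g = (\<integral>w. (\<integral>x. (\<integral>y. (\<integral>z.
     g w x * g y z * (1 - g x y) * (1 - g z w) \<partial>I01) \<partial>I01) \<partial>I01) \<partial>I01)"

text \<open>Expanding the two complementary factors leaves two disjoint edges, two paths with three
  edges, and the 4-cycle. The integration proceeds one variable at a time.\<close>

lemma alt_int_eq:
  assumes g: "graphon g"
  shows "alt_int g = (t1 g)\<^sup>2 - 2 * t3 g + t4 g"
proof -
  note [measurable (raw)] = graphon_measurable[OF g]
  have sym: "g x y = g y x" and lo: "0 \<le> g x y" and hi: "g x y \<le> 1"
    if "x \<in> {0..1}" "y \<in> {0..1}" for x y
    using graphonD[OF g that] by auto
  \<comment> \<open>Densities of walks: \<open>d\<close> and \<open>e\<close> have one and two edges
    and a free end, \<open>c\<close> and \<open>q\<close> have two and three edges and both ends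
    fixed.\<close>
  define d where "d y = (\<integral>z. g y z \<partial>I01)" for y
  define c where "c y w = (\<integral>z. g y z * g z w \<partial>I01)" for y w
  define e where "e x = (\<integral>y. g x y * d y \<partial>I01)" for x
  define q where "q x w = (\<integral>y. g x y * c y w \<partial>I01)" for x w
  have [measurable]: "d \<in> borel_measurable I01" unfolding d_def by measurable
  have [measurable (raw)]: "(\<lambda>x. c (f x) (h x)) \<in> borel_measurable N"
    if [measurable]: "f \<in> N \<rightarrow>\<^sub>M I01" "h \<in> N \<rightarrow>\<^sub>M I01" for f h and N :: "'z measure"
    unfolding c_def by measurable
  have [measurable]: "e \<in> borel_measurable I01" unfolding e_def by measurable
  have [measurable (raw)]: "(\<lambda>x. q (f x) (h x)) \<in> borel_measurable N"
    if [measurable]: "f \<in> N \<rightarrow>\<^sub>M I01" "h \<in> N \<rightarrow>\<^sub>M I01" for f h and N :: "'z measure"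
    unfolding q_def by measurable
  have d01: "0 \<le> d x" "d x \<le> 1" if "x \<in> {0..1}" for x
    unfolding d_def using that lo hi by (auto intro!: integral_I01_le integral_I01_nonneg)
  have c01: "0 \<le> c x y" "c x y \<le> 1" if "x \<in> {0..1}" "y \<in> {0..1}" for x y
    unfolding c_def using that lo hi by (auto intro!: integral_I01_le integral_I01_nonneg mult_le_one)
  have e01: "0 \<le> e x" "e x \<le> 1" if "x \<in> {0..1}" for x
    unfolding e_def using that lo hi d01 by (auto intro!: integral_I01_le integral_I01_nonneg mult_le_one)
  have q01: "0 \<le> q x y" "q x y \<le> 1" if "x \<in> {0..1}" "y \<in> {0..1}" for x y
    unfolding q_def using that lo hi c01 by (auto intro!: integral_I01_le integral_I01_nonneg mult_le_one)
  have int: "integrable I01 f" if "f \<in> borel_measurable I01" "\<And>x. x \<in> {0..1} \<Longrightarrow> 0 \<le> f x"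
    "\<And>x. x \<in> {0..1} \<Longrightarrow> f x \<le> 1" for f :: "real \<Rightarrow> real"
    by (rule integrable_I01[where C = 1]) (use that in auto)
  have d_sym: "(\<integral>w. g w x \<partial>I01) = d x" if "x \<in> {0..1}" for x
    unfolding d_def using that by (intro integral_I01_cong) (simp add: sym)
  have c_int: "(\<integral>y. c y w \<partial>I01) = e w" if w: "w \<in> {0..1}" for w
  proof -
    \<comment> \<open>A constant map into \<open>I01\<close> is measurable because its value lies in
      the unit interval; this makes sections of \<open>g\<close> accessible.\<close>
    have [measurable]: "(\<lambda>x. w) \<in> N \<rightarrow>\<^sub>M I01" for N :: "'z measure" using w by simp
    have "(\<integral>y. c y w \<partial>I01) = (\<integral>z. (\<integral>y. g y z * g z w \<partial>I01) \<partial>I01)"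
      unfolding c_def
      by (rule Fubini_I01[where C = 1]) (use w lo hi in \<open>auto intro!: mult_le_one simp: abs_mult\<close>)
    also have "\<dots> = e w"
      unfolding e_def using w by (intro integral_I01_cong) (simp add: sym[of _ w] mult.commute d_sym)
    finally show ?thesis .
  qed
  \<comment> \<open>The left side integrates a three-edge path from an inner vertex, the right side
    from an end, as in \<open>t3\<close>.\<close>
  have ed: "(\<integral>w. e w * d w \<partial>I01) = (\<integral>w. (\<integral>x. g w x * e x \<partial>I01) \<partial>I01)"
  proof -
    have "(\<integral>w. (\<integral>x. g w x * e x \<partial>I01) \<partial>I01) = (\<integral>x. (\<integral>w. g w x * e x \<partial>I01) \<partial>I01)"
      by (rule Fubini_I01[where C = 1]) (use lo hi e01 in \<open>auto intro!: mult_le_one simp: abs_mult\<close>)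
    also have "\<dots> = (\<integral>w. e w * d w \<partial>I01)"
      by (intro integral_I01_cong) (simp add: mult.commute d_sym)
    finally show ?thesis ..
  qed
  have t1: "t1 g = (\<integral>y. d y \<partial>I01)" by (simp add: t1_def d_def)
  have t3: "t3 g = (\<integral>w. (\<integral>x. g w x * e x \<partial>I01) \<partial>I01)"
    by (simp add: t3_def e_def d_def mult.assoc)
  have t4: "t4 g = (\<integral>w. (\<integral>x. g w x * q x w \<partial>I01) \<partial>I01)"
    by (simp add: t4_def q_def c_def mult.assoc)
  \<comment> \<open>\<open>1\<close>, \<open>2\<close> and \<open>3\<close> integrate out
    \<open>z\<close>, \<open>y\<close> and \<open>x\<close> in turn.\<close>
  have 1: "(\<integral>z. g w x * g y z * (1 - g x y) * (1 - g z w) \<partial>I01) = g w x * ((1 - g x y) * (d y - c y w))"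
    if wxy: "w \<in> {0..1}" "x \<in> {0..1}" "y \<in> {0..1}" for w x y
  proof -
    have [measurable]: "(\<lambda>x. w) \<in> N \<rightarrow>\<^sub>M I01" "(\<lambda>x. y) \<in> N \<rightarrow>\<^sub>M I01" for N :: "'z measure"
      using wxy by simp_all
    have "(\<integral>z. g w x * g y z * (1 - g x y) * (1 - g z w) \<partial>I01)
        = (\<integral>z. (g w x * (1 - g x y)) * (g y z - g y z * g z w) \<partial>I01)"
      by (simp add: algebra_simps)
    also have "\<dots> = (g w x * (1 - g x y)) * (d y - c y w)"
      unfolding integral_mult_right_zero c_def d_def
      by (subst Bochner_Integration.integral_diff) (use wxy lo hi in \<open>auto intro!: int mult_le_one\<close>)
    finally show ?thesis by (simp add: mult.assoc)
  qed
  have 2: "(\<integral>y. g w x * ((1 - g x y) * (d y - c y w)) \<partial>I01) = g w x * (t1 g - e w - e x + q x w)"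
    if wx: "w \<in> {0..1}" "x \<in> {0..1}" for w x
  proof -
    have [measurable]: "(\<lambda>x. w) \<in> N \<rightarrow>\<^sub>M I01" "(\<lambda>y. x) \<in> N \<rightarrow>\<^sub>M I01" for N :: "'z measure"
      using wx by simp_all
    have i: "integrable I01 d" "integrable I01 (\<lambda>y. c y w)"
      "integrable I01 (\<lambda>y. g x y * d y)" "integrable I01 (\<lambda>y. g x y * c y w)"
      using wx lo hi d01 c01 by (auto intro!: int mult_le_one)
    have "(\<integral>y. (1 - g x y) * (d y - c y w) \<partial>I01)
        = (\<integral>y. d y - c y w - g x y * d y + g x y * c y w \<partial>I01)"
      by (simp add: algebra_simps)
    also have "\<dots> = t1 g - e w - e x + q x w"
      using i c_int[OF wx(1)] by (simp add: t1 e_def[of x] q_def)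
    finally show ?thesis by simp
  qed
  have 3: "(\<integral>x. g w x * (t1 g - e w - e x + q x w) \<partial>I01)
      = t1 g * d w - e w * d w - (\<integral>x. g w x * e x \<partial>I01) + (\<integral>x. g w x * q x w \<partial>I01)"
    if w: "w \<in> {0..1}" for w
  proof -
    have [measurable]: "(\<lambda>x. w) \<in> N \<rightarrow>\<^sub>M I01" for N :: "'z measure" using w by simp
    have i: "integrable I01 (g w)" "integrable I01 (\<lambda>x. g w x * e x)" "integrable I01 (\<lambda>x. g w x * q x w)"
      using w lo hi e01 q01 by (auto intro!: int mult_le_one)
    have "(\<integral>x. g w x * (t1 g - e w - e x + q x w) \<partial>I01)
        = (\<integral>x. t1 g * g w x - e w * g w x - g w x * e x + g w x * q x w \<partial>I01)"
      by (simp add: algebra_simps)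
    also have "\<dots> = t1 g * d w - e w * d w - (\<integral>x. g w x * e x \<partial>I01) + (\<integral>x. g w x * q x w \<partial>I01)"
      using i by (simp add: d_def)
    finally show ?thesis .
  qed
  have i: "integrable I01 d" "integrable I01 (\<lambda>w. e w * d w)"
    "integrable I01 (\<lambda>w. \<integral>x. g w x * e x \<partial>I01)" "integrable I01 (\<lambda>w. \<integral>x. g w x * q x w \<partial>I01)"
    using lo hi d01 e01 q01 by (auto intro!: int mult_le_one integral_I01_le integral_I01_nonneg)
  have "alt_int g = (\<integral>w. (\<integral>x. (\<integral>y. g w x * ((1 - g x y) * (d y - c y w)) \<partial>I01) \<partial>I01) \<partial>I01)"
    unfolding alt_int_def by (intro integral_I01_cong 1)
  also have "\<dots> = (\<integral>w. (\<integral>x. g w x * (t1 g - e w - e x + q x w) \<partial>I01) \<partial>I01)"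
    by (intro integral_I01_cong 2)
  also have "\<dots> = (\<integral>w. t1 g * d w - e w * d w - (\<integral>x. g w x * e x \<partial>I01)
      + (\<integral>x. g w x * q x w \<partial>I01) \<partial>I01)"
    by (intro integral_I01_cong 3)
  also have "\<dots> = t1 g * t1 g - t3 g - t3 g + t4 g"
    using i by (simp add: t1 t3 t4 ed)
  finally show ?thesis by (simp add: power2_eq_square)
qed

lemma t1_minus_t2:
  assumes g: "graphon g"
  shows "t1 g - t2 g = (\<integral>x. degree g x - (degree g x)\<^sup>2 \<partial>I01)"
proof -
  note [measurable (raw)] = graphon_measurable[OF g]
  have [measurable]: "degree g \<in> borel_measurable I01" unfolding degree_def by measurable
  have deg: "0 \<le> degree g x" "degree g x \<le> 1" if "x \<in> {0..1}" for x
    unfolding degree_def using graphonD[OF g that]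
    by (auto intro!: integral_I01_le integral_I01_nonneg)
  have "integrable I01 (degree g)" "integrable I01 (\<lambda>x. (degree g x)\<^sup>2)"
    using deg by (auto intro!: integrable_I01[where C = 1] power_le_one)
  then show ?thesis by (simp add: t1_def t2_def degree_def[abs_def])
qed

lemma degree_measurable: "graphon g \<Longrightarrow> degree g \<in> borel_measurable I01"
  unfolding degree_def using graphon_measurable[of g] by measurable

section \<open>The two quantities for the perturbed triangle graphon\<close>

lemma gT_measurable: "(\<lambda>q. gT (fst q) (snd q)) \<in> borel_measurable (I01 \<Otimes>\<^sub>M I01)"
proof -
  have [measurable]: "(\<lambda>x. x) \<in> borel_measurable I01"
    unfolding I01_def by (rule measurable_restrict_space1) simp
  show ?thesis unfolding gT_def by measurable
qed

lemma graphon_galpha: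
  assumes "0 < \<alpha>" "\<alpha> < 1 / 2"
  shows "graphon (galpha \<alpha>)"
proof -
  note [measurable] = gT_measurable
  have "(\<lambda>q. galpha \<alpha> (fst q) (snd q)) \<in> borel_measurable (I01 \<Otimes>\<^sub>M I01)"
    unfolding galpha_def by measurable
  then show ?thesis
    using assms by (auto simp: graphon_def galpha_def gT_def add.commute)
qed

text \<open>If no factor of the integrand were \<open>\<alpha>\<close>, then
  \<open>w + x > 1\<close> and \<open>y + z > 1\<close>, but \<open>x + y \<le> 1\<close> and
  \<open>z + w \<le> 1\<close>, which contradict each other on summing.\<close>

lemma alt_int_galpha_le:
  assumes "0 < \<alpha>" "\<alpha> < 1 / 2"
  shows "alt_int (galpha \<alpha>) \<le> \<alpha>"
proof -
  let ?g = "galpha \<alpha>"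
  have val: "?g x y = (if x + y > 1 then 1 - \<alpha> else \<alpha>)" for x y
    by (simp add: galpha_def gT_def)
  have b: "0 \<le> ?g x y" "?g x y \<le> 1" "0 \<le> 1 - ?g x y" "1 - ?g x y \<le> 1" for x y
    using assms by (auto simp: val)
  have prod: "a * b * c * d \<le> \<alpha>"
    if "a \<in> {0..1}" "b \<in> {0..1}" "c \<in> {0..1}" "d \<in> {0..1}" "a = \<alpha> \<or> b = \<alpha> \<or> c = \<alpha> \<or> d = \<alpha>"
    for a b c d :: real
  proof -
    have "a * b * c * d \<le> a" "a * b * c * d \<le> b" "a * b * c * d \<le> c" "a * b * c * d \<le> d"
      using that
        mult_left_le[of "b * c * d" a] mult_left_le[of "a * c * d" b]
        mult_left_le[of "a * b * d" c] mult_left_le[of "a * b * c" d]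
      by (auto simp: mult_le_one mult_ac)
    then show ?thesis using that by auto
  qed
  have "?g w x * ?g y z * (1 - ?g x y) * (1 - ?g z w) \<le> \<alpha>" for w x y z
    by (rule prod) (use b in \<open>auto simp: val\<close>)
  then show ?thesis
    unfolding alt_int_def using assms by (intro integral_I01_le) auto
qed

lemma integral_I01_FTC:
  fixes f F :: "real \<Rightarrow> real"
  assumes "\<And>x. DERIV F x :> f x" "\<And>x. isCont f x"
  shows "(\<integral>x. f x \<partial>I01) = F 1 - F 0"
proof -
  have "(\<integral>x. f x \<partial>I01) = (\<integral>x. f x * indicator {0..1} x \<partial>lborel)"
    by (simp add: I01_def integral_restrict_space mult.commute)
  also have "\<dots> = F 1 - F 0"
    by (rule integral_FTC_Icc_real) (use assms in auto)
  finally show ?thesis .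
qed

lemma degree_galpha:
  assumes x: "x \<in> {0..1}"
  shows "degree (galpha \<alpha>) x = \<alpha> + (1 - 2 * \<alpha>) * x"
proof -
  have "(\<integral>y. gT x y \<partial>I01) = (\<integral>y. indicator {0..1} y *\<^sub>R gT x y \<partial>lborel)"
    by (simp add: I01_def integral_restrict_space)
  also have "\<dots> = (\<integral>y. (indicator {1 - x<..1} y :: real) \<partial>lborel)"
    by (rule Bochner_Integration.integral_cong) (use x in \<open>auto simp: gT_def indicator_def\<close>)
  also have "\<dots> = x" using x by simp
  finally have T: "(\<integral>y. gT x y \<partial>I01) = x" .
  have [measurable]: "(\<lambda>x. x) \<in> borel_measurable I01"
    unfolding I01_def by (rule measurable_restrict_space1) simp
  have "integrable I01 (gT x)"
    by (rule integrable_I01[where C = 1]) (auto simp: gT_def[abs_def])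
  then show ?thesis
    by (simp add: degree_def galpha_def T measure_I01_space)
qed

lemma t1_minus_t2_galpha:
  assumes "0 < \<alpha>" "\<alpha> < 1 / 2"
  shows "t1 (galpha \<alpha>) - t2 (galpha \<alpha>) \<ge> 1 / 6"
proof -
  define h where "h = 1 - 2 * \<alpha>"
  have "t1 (galpha \<alpha>) - t2 (galpha \<alpha>) = (\<integral>x. (\<alpha> + h * x) - (\<alpha> + h * x)\<^sup>2 \<partial>I01)"
    unfolding t1_minus_t2[OF graphon_galpha[OF assms]]
    by (intro integral_I01_cong) (auto simp: degree_galpha h_def)
  \<comment> \<open>One antiderivative at 1 and at 0, left unsimplified so that matching recovers
    it.\<close>
  also have "\<dots> = (\<alpha> * 1 + h * 1\<^sup>2 / 2 - (\<alpha>\<^sup>2 * 1 + \<alpha> * h * 1\<^sup>2 + h\<^sup>2 * 1 ^ 3 / 3))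
      - (\<alpha> * 0 + h * 0\<^sup>2 / 2 - (\<alpha>\<^sup>2 * 0 + \<alpha> * h * 0\<^sup>2 + h\<^sup>2 * 0 ^ 3 / 3))"
    by (rule integral_I01_FTC)
      (auto intro!: derivative_eq_intros continuous_intros simp: power2_eq_square algebra_simps)
  also have "\<dots> = 1 / 6 + \<alpha> * (1 - \<alpha>) / 3"
    by (simp add: h_def power2_eq_square field_simps)
  also have "\<dots> \<ge> 1 / 6" using assms by simp
  finally show ?thesis .
qed

subsection \<open>Podal graphons\<close>

lemma AE_I01_pick:
  assumes "AE x in I01. P x" "measure I01 V > 0"
  obtains x where "x \<in> V" "x \<in> {0..1}" "P x"
proof -
  \<comment> \<open>Non-measurable sets have \<open>measure\<close> 0.\<close>
  have "V \<in> sets I01" using assms(2) measure_notin_sets by fastforce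
  moreover have "\<not> (AE x in I01. x \<notin> V)"
    using assms(2) calculation by (simp add: AE_iff_null_sets[symmetric] null_sets_def I01.emeasure_eq_measure)
  ultimately show ?thesis using assms(1) that by (metis (mono_tags, lifting) AE_I2 AE_mp space_I01)
qed

text \<open>\<open>k\<close> sends a point to the index of its block. Agreement with the step
  function is stated by nested \<open>AE\<close> to suit iterated integrals.\<close>

lemma podal_step_data:
  assumes g: "graphon g" and podal: "podal M g"
  obtains p a k where "(p, a) \<in> step_data M" "k \<in> I01 \<rightarrow>\<^sub>M count_space UNIV"
    "\<And>f :: nat \<Rightarrow> real. (\<integral>x. f (k x) \<partial>I01) = (\<Sum>i<M. p i * f i)"
    "AE x in I01. AE y in I01. g x y = a (k x) (k y)"
proof -
  obtain m V where m: "m \<le> M" and V: "\<forall>i<m. V i \<in> sets I01"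
    and cover: "(\<Union>i<m. V i) = {0..1}" and disj: "disjoint_family_on V {..<m}"
    and const: "\<forall>i<m. \<forall>j<m. \<exists>c. AE q in I01 \<Otimes>\<^sub>M I01.
      q \<in> V i \<times> V j \<longrightarrow> g (fst q) (snd q) = c"
    using podal unfolding podal_def by (elim exE conjE) (rule that)
  define c where "c i j = (SOME c. AE q in I01 \<Otimes>\<^sub>M I01. q \<in> V i \<times> V j \<longrightarrow> g (fst q) (snd q) = c)" for i j
  have c: "AE q in I01 \<Otimes>\<^sub>M I01. q \<in> V i \<times> V j \<longrightarrow> g (fst q) (snd q) = c i j"
    if "i < m" "j < m" for i j
    unfolding c_def by (rule someI_ex) (use const that in simp)
  define k where "k x = (if x \<in> {0..1} then THE i. i < m \<and> x \<in> V i else 0)" for x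
  have k_eq: "k x = i" if "i < m" "x \<in> V i" for x i
  proof -
    have "x \<in> {0..1}" using that cover by auto
    then show ?thesis
      using that disj by (auto simp: k_def disjoint_family_on_def intro!: the_equality)
  qed
  have kV: "k x < m" "x \<in> V (k x)" if "x \<in> {0..1}" for x
  proof -
    from that obtain i where "i < m" "x \<in> V i" using cover by blast
    then show "k x < m" "x \<in> V (k x)" using k_eq by simp_all
  qed
  have pre: "k -` {i} \<inter> {0..1} = (if i < m then V i else {})" for i
  proof (intro set_eqI iffI)
    show "x \<in> (if i < m then V i else {})" if "x \<in> k -` {i} \<inter> {0..1}" for x
      using kV[of x] that by auto
    show "x \<in> k -` {i} \<inter> {0..1}" if "x \<in> (if i < m then V i else {})" for x
      using k_eq[of i x] that cover by (auto split: if_splits)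
  qed
  have k [measurable]: "k \<in> I01 \<rightarrow>\<^sub>M count_space UNIV"
    using V by (subst measurable_count_space_eq2_countable) (auto simp: pre)
  \<comment> \<open>Indices from \<open>m\<close> on have an empty preimage and weight 0, which pads
    the partition to \<open>M\<close> blocks.\<close>
  define p where "p i = measure I01 (k -` {i} \<inter> {0..1})" for i
  have pint: "(\<integral>x. f (k x) \<partial>I01) = (\<Sum>i<M. p i * f i)" for f :: "nat \<Rightarrow> real"
  proof -
    have "(\<integral>x. f (k x) \<partial>I01) = (\<integral>x. (\<Sum>i<M. indicator (k -` {i} \<inter> {0..1}) x * f i) \<partial>I01)"
    proof (rule Bochner_Integration.integral_cong[OF refl])
      fix x assume "x \<in> space I01"
      then have x: "x \<in> {0..1}" by simp
      have "(\<Sum>i<M. indicator (k -` {i} \<inter> {0..1}) x * f i) = (\<Sum>i<M. if i = k x then f i else 0)"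
        by (rule sum.cong) (use x in \<open>auto simp: indicator_def\<close>)
      also have "\<dots> = f (k x)" using kV(1)[OF x] m by simp
      finally show "f (k x) = (\<Sum>i<M. indicator (k -` {i} \<inter> {0..1}) x * f i)" ..
    qed
    also have "\<dots> = (\<Sum>i<M. (\<integral>x. indicator (k -` {i} \<inter> {0..1}) x * f i \<partial>I01))"
      using V by (intro Bochner_Integration.integral_sum integrable_I01[where C = "\<bar>f _\<bar>"])
        (auto simp: pre indicator_def)
    also have "\<dots> = (\<Sum>i<M. p i * f i)"
      by (simp add: p_def)
    finally show ?thesis .
  qed
  \<comment> \<open>If a block is null, \<open>c i j\<close> is an arbitrary choice that may break
    symmetry or leave the unit interval, so it is reset to 0; by \<open>pk\<close> almost no point
    notices.\<close>
  define a where "a i j = (if p i > 0 \<and> p j > 0 then c i j else 0)" for i j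
  have pk: "AE x in I01. p (k x) > 0"
  proof -
    have "AE x in I01. i < m \<longrightarrow> p i = 0 \<longrightarrow> x \<notin> V i" for i
    proof (cases "i < m \<and> p i = 0")
      case True
      then have "measure I01 (V i) = 0" "V i \<in> sets I01" using V by (auto simp: p_def pre)
      then have "V i \<in> null_sets I01"
        by (intro null_setsI) (simp_all add: I01.emeasure_eq_measure)
      then have "AE x in I01. x \<notin> V i" by (rule AE_not_in)
      then show ?thesis by eventually_elim simp
    next
      case False
      then show ?thesis by (intro AE_I2 impI) simp
    qed
    then have "AE x in I01. \<forall>i. i < m \<longrightarrow> p i = 0 \<longrightarrow> x \<notin> V i"
      unfolding AE_all_countable by (rule allI)
    with AE_space show ?thesis
    proof eventually_elim
      case (elim x)
      then have "p (k x) \<noteq> 0" using kV[of x] by auto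
      then show ?case by (simp add: p_def zero_less_measure_iff)
    qed
  qed
  have "AE q in I01 \<Otimes>\<^sub>M I01. \<forall>i j. i < m \<longrightarrow> j < m \<longrightarrow> q \<in> V i \<times> V j \<longrightarrow> g (fst q) (snd q) = c i j"
    unfolding AE_all_countable
  proof (intro allI)
    show "AE q in I01 \<Otimes>\<^sub>M I01. i < m \<longrightarrow> j < m \<longrightarrow> q \<in> V i \<times> V j \<longrightarrow> g (fst q) (snd q) = c i j" for i j
    proof (cases "i < m \<and> j < m")
      case True
      then show ?thesis using c[of i j] by simp
    next
      case False
      then show ?thesis by (intro AE_I2 impI) simp
    qed
  qed
  with AE_space have cq: "AE q in I01 \<Otimes>\<^sub>M I01. g (fst q) (snd q) = c (k (fst q)) (k (snd q))"
  proof eventually_elim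
    case (elim q)
    then have "fst q \<in> {0..1}" "snd q \<in> {0..1}" by (auto simp: space_pair_measure)
    then show ?case using elim(2) kV by (simp add: mem_Times_iff)
  qed
  \<comment> \<open>The coordinate swap preserves the measure, which gives the statement for
    \<open>g y x\<close> as well.\<close>
  then have "AE q in distr (I01 \<Otimes>\<^sub>M I01) (I01 \<Otimes>\<^sub>M I01) (\<lambda>(x, y). (y, x)).
      g (fst q) (snd q) = c (k (fst q)) (k (snd q))"
    by (simp only: I01.distr_pair_swap[symmetric])
  from AE_distrD[OF measurable_pair_swap' this]
  have cq': "AE q in I01 \<Otimes>\<^sub>M I01. g (snd q) (fst q) = c (k (snd q)) (k (fst q))"
    by (simp add: case_prod_beta)
  have cxy: "AE x in I01. AE y in I01. g x y = c (k x) (k y)" using I01.AE_pair[OF cq] by simp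
  have cyx: "AE x in I01. AE y in I01. g y x = c (k y) (k x)" using I01.AE_pair[OF cq'] by simp
  have ga: "AE x in I01. AE y in I01. g x y = a (k x) (k y)"
    using cxy pk
  proof eventually_elim
    case (elim x)
    from elim(1) pk show ?case by eventually_elim (use elim in \<open>simp add: a_def\<close>)
  qed
  \<comment> \<open>Symmetry and range pass from \<open>g\<close> to \<open>c\<close> at a generic
    point of the two blocks: first \<open>x\<close> is picked, then \<open>y\<close> depending on
    it.\<close>
  have c_prop: "c i j = c j i \<and> c i j \<in> {0..1}" if pos: "p i > 0" "p j > 0" for i j
  proof -
    have "AE x in I01. (AE y in I01. g x y = c (k x) (k y)) \<and> (AE y in I01. g y x = c (k y) (k x))"
      using cxy cyx by eventually_elim simp
    then obtain x where x: "k x = i" "x \<in> {0..1}"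
      "(AE y in I01. g x y = c (k x) (k y)) \<and> (AE y in I01. g y x = c (k y) (k x))"
      by (rule AE_I01_pick[where V = "k -` {i} \<inter> {0..1}"]) (use pos in \<open>auto simp: p_def\<close>)
    from x(3) have "AE y in I01. g x y = c (k x) (k y) \<and> g y x = c (k y) (k x)" by simp
    then obtain y where y: "k y = j" "y \<in> {0..1}" "g x y = c (k x) (k y) \<and> g y x = c (k y) (k x)"
      by (rule AE_I01_pick[where V = "k -` {j} \<inter> {0..1}"]) (use pos in \<open>auto simp: p_def\<close>)
    show ?thesis using graphonD[OF g x(2) y(2)] x(1) y by auto
  qed
  have "p i \<in> {0..1}" for i
    using I01.bounded_measure[of "k -` {i} \<inter> {0..1}"] by (simp add: p_def measure_I01_space)
  moreover have "(\<Sum>i<M. p i) = 1" using pint[of "\<lambda>_. 1"] by (simp add: measure_I01_space)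
  ultimately have "(p, a) \<in> step_data M"
    using c_prop by (auto simp: step_data_def a_def)
  then show ?thesis using that k pint ga by blast
qed

text \<open>\<open>g\<close> is replaced by the exact step function \<open>A\<close>, whose
  integrals become weighted sums by \<open>pint\<close>.\<close>

lemma step_graphon_values:
  assumes g: "graphon g" and S: "(p, a) \<in> step_data M"
    and k [measurable]: "k \<in> I01 \<rightarrow>\<^sub>M count_space UNIV"
    and pint: "\<And>f :: nat \<Rightarrow> real. (\<integral>x. f (k x) \<partial>I01) = (\<Sum>i<M. p i * f i)"
    and ga: "AE x in I01. AE y in I01. g x y = a (k x) (k y)"
  shows "alt_int g = alt4 M p a" "t1 g - t2 g = degvar M p a"
proof -
  define A where "A x y = a (k x) (k y)" for x y
  have "(\<lambda>q. A (fst q) (snd q)) \<in> borel_measurable (I01 \<Otimes>\<^sub>M I01)"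
    unfolding A_def
    by (rule measurable_compose_countable[where g = "\<lambda>q. k (fst q)"],
        rule measurable_compose_countable[where g = "\<lambda>q. k (snd q)"]) measurable
  then have A: "graphon A"
    using S by (auto simp: graphon_def A_def step_data_def)
  note [measurable (raw)] = graphon_measurable[OF g] graphon_measurable[OF A]
  \<comment> \<open>The points whose row of \<open>g\<close> agrees almost everywhere with that of
    \<open>A\<close>.\<close>
  define W where "W x \<longleftrightarrow> (AE y in I01. g x y = A x y)" for x
  have W: "AE x in I01. W x" using ga by (simp add: W_def A_def)
  have degA: "degree A x = (\<Sum>j<M. p j * a (k x) j)" for x
    unfolding degree_def A_def by (rule pint)
  have "t1 g - t2 g = (\<integral>x. degree g x - (degree g x)\<^sup>2 \<partial>I01)"
    by (rule t1_minus_t2[OF g])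
  also have "\<dots> = (\<integral>x. degree A x - (degree A x)\<^sup>2 \<partial>I01)"
  proof (rule integral_cong_AE)
    note [measurable] = degree_measurable[OF g] degree_measurable[OF A]
    show "(\<lambda>x. degree g x - (degree g x)\<^sup>2) \<in> borel_measurable I01"
      "(\<lambda>x. degree A x - (degree A x)\<^sup>2) \<in> borel_measurable I01"
      by measurable
    show "AE x in I01. degree g x - (degree g x)\<^sup>2 = degree A x - (degree A x)\<^sup>2"
      using W AE_space
    proof eventually_elim
      case (elim x)
      then have [measurable]: "(\<lambda>y. x) \<in> N \<rightarrow>\<^sub>M I01" for N :: "real measure" by simp
      have "degree g x = degree A x"
        unfolding degree_def by (rule integral_cong_AE) (use elim in \<open>auto simp: W_def\<close>)
      then show ?case by simp
    qed
  qed
  also have "\<dots> = degvar M p a"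
    unfolding degA degvar_def
    by (rule pint[of "\<lambda>i. (\<Sum>j<M. p j * a i j) - (\<Sum>j<M. p j * a i j)\<^sup>2"])
  finally show "t1 g - t2 g = degvar M p a" .
  have "alt_int g = alt_int A"
    unfolding alt_int_def
  proof (rule integral_cong_AE)
    show "AE w in I01. (\<integral>x. (\<integral>y. (\<integral>z. g w x * g y z * (1 - g x y) * (1 - g z w) \<partial>I01) \<partial>I01) \<partial>I01)
      = (\<integral>x. (\<integral>y. (\<integral>z. A w x * A y z * (1 - A x y) * (1 - A z w) \<partial>I01) \<partial>I01) \<partial>I01)"
      using W AE_space
    proof eventually_elim
      case w: (elim w)
      then have [measurable]: "(\<lambda>y. w) \<in> N \<rightarrow>\<^sub>M I01" for N :: "'z measure" by simp
      show ?case
      proof (rule integral_cong_AE)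
        show "AE x in I01. (\<integral>y. (\<integral>z. g w x * g y z * (1 - g x y) * (1 - g z w) \<partial>I01) \<partial>I01)
          = (\<integral>y. (\<integral>z. A w x * A y z * (1 - A x y) * (1 - A z w) \<partial>I01) \<partial>I01)"
          using W AE_space w(1)[unfolded W_def]
        proof eventually_elim
          case x: (elim x)
          then have [measurable]: "(\<lambda>y. x) \<in> N \<rightarrow>\<^sub>M I01" for N :: "'z measure" by simp
          show ?case
          proof (rule integral_cong_AE)
            show "AE y in I01. (\<integral>z. g w x * g y z * (1 - g x y) * (1 - g z w) \<partial>I01)
              = (\<integral>z. A w x * A y z * (1 - A x y) * (1 - A z w) \<partial>I01)"
              using W AE_space x(1)[unfolded W_def]
            proof eventually_elim
              case y: (elim y)
              then have [measurable]: "(\<lambda>z. y) \<in> N \<rightarrow>\<^sub>M I01" for N :: "'z measure" by simp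
              show ?case
              proof (rule integral_cong_AE)
                show "AE z in I01. g w x * g y z * (1 - g x y) * (1 - g z w)
                  = A w x * A y z * (1 - A x y) * (1 - A z w)"
                  using y(1)[unfolded W_def] w(1)[unfolded W_def] AE_space
                proof eventually_elim
                  case (elim z)
                  \<comment> \<open>The other factors come from the rows of \<open>w\<close>,
                    \<open>x\<close> and \<open>y\<close>; this one also lies in the row of
                    \<open>w\<close>, after a use of symmetry.\<close>
                  have "g z w = A z w"
                    using elim w graphonD(1)[OF g, of z w] graphonD(1)[OF A, of z w] by simp
                  then show ?case using elim x y by simp
                qed
              qed measurable
            qed
          qed measurable
        qed
      qed measurable
    qed
  qed measurable
  also have "\<dots> = alt4 M p a"
  proof -
    have 1: "(\<integral>z. a i j * a l (k z) * (1 - a j l) * (1 - a (k z) i) \<partial>I01)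
      = (\<Sum>z<M. p z * (a i j * a l z * (1 - a j l) * (1 - a z i)))" for i j l
      by (rule pint)
    have 2: "(\<integral>y. (\<Sum>z<M. p z * (a i j * a (k y) z * (1 - a j (k y)) * (1 - a z i))) \<partial>I01)
      = (\<Sum>y<M. p y * (\<Sum>z<M. p z * (a i j * a y z * (1 - a j y) * (1 - a z i))))" for i j
      by (rule pint)
    have 3: "(\<integral>x. (\<Sum>y<M. p y * (\<Sum>z<M. p z * (a i (k x) * a y z * (1 - a (k x) y) * (1 - a z i)))) \<partial>I01)
      = (\<Sum>x<M. p x * (\<Sum>y<M. p y * (\<Sum>z<M. p z * (a i x * a y z * (1 - a x y) * (1 - a z i)))))" for i
      by (rule pint)
    show ?thesis
      unfolding alt_int_def A_def alt4_def 1 2 3 by (rule pint)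
  qed
  finally show "alt_int g = alt4 M p a" .
qed

theorem theorem8p2:
  fixes M :: nat
  assumes "M \<ge> 1"
  shows "\<exists>\<epsilon>>0. \<forall>\<alpha>::real. 0 < \<alpha> \<and> \<alpha> < \<epsilon> \<longrightarrow>
           \<not> (\<exists>g. graphon g \<and> podal M g \<and>
                 t1 g = t1 (galpha \<alpha>) \<and> t2 g = t2 (galpha \<alpha>) \<and>
                 t3 g = t3 (galpha \<alpha>) \<and> t4 g = t4 (galpha \<alpha>))"
proof -
  obtain \<epsilon> where \<epsilon>: "\<epsilon> > 0"
    and gap: "\<And>p a. (p, a) \<in> step_data M \<Longrightarrow> degvar M p a \<ge> 1 / 6 \<Longrightarrow> alt4 M p a \<ge> \<epsilon>"
    using step_data_gap by metis
  \<comment> \<open>The extra bound \<open>\<alpha> < 1 / 2\<close> makes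
    \<open>galpha \<alpha>\<close> fall under the lemmas above; it is absorbed into the final
    minimum.\<close>
  have False if \<alpha>: "0 < \<alpha>" "\<alpha> < \<epsilon>" "\<alpha> < 1 / 2" and g: "graphon g" "podal M g"
    and eq: "t1 g = t1 (galpha \<alpha>)" "t2 g = t2 (galpha \<alpha>)"
      "t3 g = t3 (galpha \<alpha>)" "t4 g = t4 (galpha \<alpha>)" for \<alpha> g
  proof -
    obtain p a k where S: "(p, a) \<in> step_data M" and k: "k \<in> I01 \<rightarrow>\<^sub>M count_space UNIV"
      "\<And>f :: nat \<Rightarrow> real. (\<integral>x. f (k x) \<partial>I01) = (\<Sum>i<M. p i * f i)"
      "AE x in I01. AE y in I01. g x y = a (k x) (k y)"
      using podal_step_data[OF g] by blast
    note v = step_graphon_values[OF g(1) S k]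
    have "degvar M p a \<ge> 1 / 6" using v(2) t1_minus_t2_galpha[OF \<alpha>(1,3)] eq by simp
    then have "\<epsilon> \<le> alt_int g" using gap[OF S] v(1) by simp
    also have "\<dots> = alt_int (galpha \<alpha>)"
      using eq by (simp add: alt_int_eq[OF g(1)] alt_int_eq[OF graphon_galpha[OF \<alpha>(1,3)]])
    also have "\<dots> \<le> \<alpha>" by (rule alt_int_galpha_le[OF \<alpha>(1,3)])
    finally show False using \<alpha> by simp
  qed
  then show ?thesis
    using \<epsilon> by (intro exI[of _ "min \<epsilon> (1 / 2)"]) auto
qed

end
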